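(* Let $n\ge 5$ and let $S_n$ be the symmetric group on $n$ letters. Then the difference graph $\mathcal{D}(S_n)$ is a cograph if and only if $n=5$.
   Context: Difference graph: for a finite group $G$, the power graph $\mathcal{P}(G)$ is the simple undirected graph with vertex set $G$ in which distinct $a,b$ are adjacent iff $a\in\langle b\rangle$ or $b\in\langle a\rangle$. The enhanced power graph $\mathcal{P}_E(G)$ is the simple undirected graph with vertex set $G$ in which distinct $a,b$ are adjacent iff $a,b\in\langle c\rangle$ for some $c\in G$. The difference graph $\mathcal{D}(G)$ is obtained from the graph $\mathcal{P}_E(G)-\mathcal{P}(G)$ (vertex set $G$; two vertices are adjacent iff they are adjacent in $\mathcal{P}_E(G)$ but not in $\mathcal{P}(G)$) by removing all isolated vertices. A graph is a cograph if it has no induced subgraph isomorphic to the path $P_4$ on 4 vertices. *)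

theory Defs
  imports
    "HOL-Algebra.Sym_Groups"
    "Graph_Theory.Digraph_Component"
    "Graph_Theory.Digraph_Isomorphism"
    "Graph_Theory.Pair_Digraph"
begin

text \<open>
  As in \<^theory>\<open>Graph_Theory.Pair_Digraph\<close>, a finite simple undirected graph is a symmetric
  loop-free digraph without parallel arcs (\<^const>\<open>pair_graph\<close>, respectively \<^const>\<open>graph\<close>):
  each edge is present as the two arcs \<^term>\<open>(a, b)\<close> and \<^term>\<open>(b, a)\<close>.
\<close>

definition power_graph :: "('a, 'm) monoid_scheme \<Rightarrow> 'a pair_pre_digraph" where
  "power_graph G = \<lparr> pverts = carrier G,
     parcs = {(a, b). a \<in> carrier G \<and> b \<in> carrier G \<and> a \<noteq> b \<and>
       (a \<in> generate G {b} \<or> b \<in> generate G {a})} \<rparr>"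

definition enhanced_power_graph :: "('a, 'm) monoid_scheme \<Rightarrow> 'a pair_pre_digraph" where
  "enhanced_power_graph G = \<lparr> pverts = carrier G,
     parcs = {(a, b). a \<in> carrier G \<and> b \<in> carrier G \<and> a \<noteq> b \<and>
       (\<exists>c \<in> carrier G. a \<in> generate G {c} \<and> b \<in> generate G {c})} \<rparr>"

text \<open>The difference of two graphs on the same vertex set keeps that vertex set.\<close>

definition graph_minus :: "'a pair_pre_digraph \<Rightarrow> 'a pair_pre_digraph \<Rightarrow> 'a pair_pre_digraph" where
  "graph_minus A B = \<lparr> pverts = pverts A, parcs = parcs A - parcs B \<rparr>"

text \<open>Only outgoing arcs are inspected, which suffices because the graphs are symmetric.\<close>

definition remove_isolated :: "'a pair_pre_digraph \<Rightarrow> 'a pair_pre_digraph" where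
  "remove_isolated A =
     \<lparr> pverts = {a \<in> pverts A. \<exists>b \<in> pverts A. (a, b) \<in> parcs A}, parcs = parcs A \<rparr>"

definition difference_graph :: "('a, 'm) monoid_scheme \<Rightarrow> 'a pair_pre_digraph" where
  "difference_graph G = remove_isolated (graph_minus (enhanced_power_graph G) (power_graph G))"

definition path_graph :: "nat \<Rightarrow> nat pair_pre_digraph" where
  "path_graph n = \<lparr> pverts = {..<n},
     parcs = {(i, j). i < n \<and> j < n \<and> (j = Suc i \<or> i = Suc j)} \<rparr>"

definition cograph :: "('a, 'b) pre_digraph \<Rightarrow> bool" where
  "cograph G \<longleftrightarrow> graph G \<and>
     \<not> (\<exists>H. induced_subgraph H G \<and> digraph_iso H (with_proj (path_graph 4)))"

lemma parcs_difference_graph: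
  "(a, b) \<in> parcs (difference_graph G) \<longleftrightarrow>
     a \<in> carrier G \<and> b \<in> carrier G \<and> a \<noteq> b \<and>
     (\<exists>c \<in> carrier G. a \<in> generate G {c} \<and> b \<in> generate G {c}) \<and>
     a \<notin> generate G {b} \<and> b \<notin> generate G {a}"
  by (auto simp: difference_graph_def remove_isolated_def graph_minus_def
      enhanced_power_graph_def power_graph_def)

lemma pverts_difference_graph:
  "pverts (difference_graph G) =
     {a \<in> carrier G. \<exists>b \<in> carrier G. (a, b) \<in> parcs (difference_graph G)}"
  by (simp add: difference_graph_def remove_isolated_def graph_minus_def enhanced_power_graph_def)

lemma pair_graph_difference_graph:
  assumes "finite (carrier G)"
  shows "pair_graph (difference_graph G)"
proof -
  let ?D = "difference_graph G"
  have arc: "a \<in> carrier G \<and> b \<in> carrier G \<and> a \<noteq> b \<and> (b, a) \<in> parcs ?D"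
    if "(a, b) \<in> parcs ?D" for a b
    using that unfolding parcs_difference_graph by blast
  have "finite (parcs ?D)"
    by (rule finite_subset[of _ "carrier G \<times> carrier G"]) (use arc assms in auto)
  moreover have "finite (pverts ?D)"
    using assms by (simp add: pverts_difference_graph)
  moreover have "fst e \<in> pverts ?D \<and> snd e \<in> pverts ?D \<and> fst e \<noteq> snd e"
    if "e \<in> parcs ?D" for e
    using that arc[of "fst e" "snd e"] by (cases e) (auto simp: pverts_difference_graph)
  moreover have "symmetric ?D"
    using arc by (auto simp: symmetric_def sym_def)
  ultimately show ?thesis
    by unfold_locales auto
qed

lemma pair_graph_path_graph: "pair_graph (path_graph n)"
proof -
  have "finite (parcs (path_graph n))"
    by (rule finite_subset[of _ "{..<n} \<times> {..<n}"]) (auto simp: path_graph_def)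
  then show ?thesis
    by unfold_locales (auto simp: path_graph_def symmetric_def sym_def)
qed

end

theory Submission
  imports Defs "HOL-Number_Theory.Cong" "HOL-Algebra.Multiplicative_Group"
begin

text \<open>
  An edge of the difference graph joins two powers of a single element \<open>c\<close>, neither of which is a
  power of the other; in particular \<open>c\<close> does not have prime power order. In the symmetric group on
  five letters only the products of a 3-cycle and a disjoint transposition qualify, so every edge
  joins a 3-cycle to the transposition of its two fixed points. Hence one endpoint of every edge is
  a leaf, which excludes an induced path on four vertices. For at least six letters such a path is
  \<open>(5 6), (1 2 3), (4 5), (1 2 6)\<close>.
\<close>

section \<open>Induced paths\<close>

text \<open>Replaces subgraphs and isomorphisms by a labelling of the path: inverting the vertex map
  of an isomorphism yields \<open>f\<close>, and conversely the image of \<open>f\<close> induces a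
  subgraph that the inverse of \<open>f\<close> carries onto the path.\<close>

lemma cograph_iff:
  assumes "pair_graph D"
  shows "cograph (with_proj D) \<longleftrightarrow>
    \<not> (\<exists>f. inj_on f {..<4} \<and>
      (\<forall>i<4. \<forall>j<4. (f i, f j) \<in> parcs D \<longleftrightarrow> (i, j) \<in> parcs (path_graph 4)))"
    (is "_ \<longleftrightarrow> \<not> (\<exists>f. ?P f)")
proof -
  interpret pair_graph D by fact
  have "graph (with_proj D)" by unfold_locales
  moreover have "\<exists>f. ?P f"
    if H: "induced_subgraph H (with_proj D)" and iso: "digraph_iso H (with_proj (path_graph 4))" for H
  proof -
    from iso obtain h where h: "pre_digraph.digraph_isomorphism H h"
      and eq: "with_proj (path_graph 4) = app_iso h H"
      unfolding digraph_iso_def by blast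
    let ?g = "iso_verts h"
    have vH: "?g ` verts H = {..<4}" and aH: "iso_arcs h ` arcs H = parcs (path_graph 4)"
      and tl: "iso_tail h = fst" and hd: "iso_head h = snd"
      using arg_cong[OF eq, of verts] arg_cong[OF eq, of arcs]
        arg_cong[OF eq, of tail] arg_cong[OF eq, of head]
      by (simp_all add: path_graph_def)
    have inj: "inj_on ?g (verts H)"
      using h by (simp add: pre_digraph.digraph_isomorphism_def)
    have tH: "tail H = fst" and hH: "head H = snd"
      and arcs: "arcs H = {e \<in> parcs D. fst e \<in> verts H \<and> snd e \<in> verts H}"
      using H by (auto simp: induced_subgraph_def subgraph_def compatible_def)
    \<comment> \<open>Tail and head are \<open>fst\<close> and \<open>snd\<close> in both graphs, so
      the action of \<open>h\<close> on arcs is forced by its action on vertices.\<close>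
    have img: "iso_arcs h e = (?g (fst e), ?g (snd e))" if "e \<in> arcs H" for e
      using h that tl hd tH hH
      by (auto simp: pre_digraph.digraph_isomorphism_def intro: prod_eqI)
    let ?f = "the_inv_into (verts H) ?g"
    have f: "?f i \<in> verts H" "?g (?f i) = i" if "i < 4" for i
      using that vH inj by (auto intro: the_inv_into_into f_the_inv_into_f)
    have "inj_on ?f {..<4}"
      by (metis f(2) inj_onI lessThan_iff)
    moreover have "(?f i, ?f j) \<in> parcs D \<longleftrightarrow> (i, j) \<in> parcs (path_graph 4)"
      if ij: "i < 4" "j < 4" for i j
    proof
      assume "(?f i, ?f j) \<in> parcs D"
      then have "(?f i, ?f j) \<in> arcs H" using f ij arcs by simp
      then show "(i, j) \<in> parcs (path_graph 4)"
        using img[of "(?f i, ?f j)"] f ij aH by (metis fst_conv imageI snd_conv)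
    next
      assume "(i, j) \<in> parcs (path_graph 4)"
      then obtain e where e: "e \<in> arcs H" "iso_arcs h e = (i, j)" using aH by (metis imageE)
      then have "?g (fst e) = i" "?g (snd e) = j" using img by auto
      moreover have "fst e \<in> verts H" "snd e \<in> verts H" using e arcs by auto
      ultimately have "fst e = ?f i" "snd e = ?f j"
        using inj by (auto simp: the_inv_into_f_f)
      then show "(?f i, ?f j) \<in> parcs D" using e arcs by (metis (lifting) mem_Collect_eq prod.collapse)
    qed
    ultimately show ?thesis by blast
  qed
  moreover have "\<exists>H. induced_subgraph H (with_proj D) \<and> digraph_iso H (with_proj (path_graph 4))"
    if f: "?P f" for f
  proof -
    have inj: "inj_on f {..<4}"
      and arc: "\<And>i j. i < 4 \<Longrightarrow> j < 4 \<Longrightarrow> (f i, f j) \<in> parcs D \<longleftrightarrow> (i, j) \<in> parcs (path_graph 4)"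
      using f by blast+
    let ?V = "f ` {..<4}"
    let ?H = "with_proj D \<restriction> ?V"
    let ?g = "the_inv_into {..<4} f"
    \<comment> \<open>Each vertex of the path has a neighbour, its predecessor or 1 in the case of
      0, so \<open>f i\<close> is an endpoint of an arc of \<open>D\<close>.\<close>
    have "f i \<in> pverts D" if "i < 4" for i
    proof -
      have "\<exists>j<4. (i, j) \<in> parcs (path_graph 4)"
        using that
        by (intro exI[of _ "if i = 0 then 1 else i - 1"]) (auto simp: path_graph_def)
      then show ?thesis using arc that in_arcsD1 by blast
    qed
    then have "induced_subgraph ?H (with_proj D)"
      by (intro induced_induce) auto
    moreover have g: "?g (f i) = i" if "i < 4" for i
      using inj that by (simp add: the_inv_into_f_f)
    let ?h = "\<lparr> iso_verts = ?g, iso_arcs = map_prod ?g ?g, iso_head = snd, iso_tail = fst \<rparr>"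
    have gV: "inj_on ?g ?V" using g by (auto intro!: inj_onI)
    have "inj_on (map_prod ?g ?g) (arcs ?H)"
      by (rule inj_on_subset[OF map_prod_inj_on[OF gV gV]]) auto
    then have "pre_digraph.digraph_isomorphism ?H ?h"
      unfolding pre_digraph.digraph_isomorphism_def using gV by auto
    moreover have "map_prod ?g ?g ` arcs ?H = parcs (path_graph 4)" (is "?L = ?R")
    proof
      show "?L \<subseteq> ?R" using arc g by auto
      show "?R \<subseteq> ?L"
      proof
        fix e assume e: "e \<in> ?R"
        obtain i j where ij: "e = (i, j)" by fastforce
        then have "i < 4" "j < 4" using e by (auto simp: path_graph_def)
        then show "e \<in> ?L"
          using e ij arc g by (intro image_eqI[of _ _ "(f i, f j)"]) auto
      qed
    qed
    moreover have "?g ` ?V = {..<4}" using g by (auto simp: image_image)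
    ultimately show ?thesis
      unfolding digraph_iso_def
      by (intro exI[of _ ?H] conjI exI[of _ ?h])
        (auto simp: app_iso_def with_proj_def path_graph_def)
  qed
  ultimately show ?thesis
    unfolding cograph_def by blast
qed

section \<open>Powers of a permutation\<close>

text \<open>Bezout: \<open>gcd i m\<close> is congruent to a multiple of \<open>i\<close> modulo
  \<open>m\<close>, hence so is \<open>j\<close>, and exponents of \<open>c\<close> count only
  modulo \<open>m\<close>.\<close>

lemma funpow_power_of_power:
  fixes c :: "'a \<Rightarrow> 'a"
  assumes "c ^^ m = id" "gcd i m dvd j"
  shows "\<exists>l. c ^^ j = (c ^^ i) ^^ l"
proof -
  from cong_solve_nat[of i m] obtain x where x: "[i * x = gcd i m] (mod m)" by blast
  obtain q where q: "j = gcd i m * q" using assms by auto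
  have "[i * (x * q) = j] (mod m)"
    using cong_scalar_right[OF x, of q] q by (simp add: mult.assoc)
  moreover have "c ^^ (k mod m) = c ^^ k" for k
    using assms(1) by (intro ext funpow_mod_eq) simp
  ultimately have "c ^^ (i * (x * q)) = c ^^ j"
    unfolding cong_def by metis
  then show ?thesis unfolding funpow_mult by metis
qed

text \<open>The divisors of a prime power form a chain. Together with
  \<open>funpow_power_of_power\<close> this means that an element of prime power order is never the
  common root of an edge.\<close>

lemma prime_power_gcd_dvd:
  fixes i j :: nat
  assumes "prime p"
  shows "gcd i (p ^ k) dvd j \<or> gcd j (p ^ k) dvd i"
proof -
  obtain r s where r: "gcd i (p ^ k) = p ^ r" and s: "gcd j (p ^ k) = p ^ s"
    using divides_primepow_nat[OF assms] by (metis gcd_dvd2)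
  show ?thesis
  proof (cases "r \<le> s")
    case True
    then have "p ^ r dvd p ^ s" by (simp add: le_imp_power_dvd)
    then show ?thesis using r s by (metis dvd_trans gcd_dvd1)
  next
    case False
    then have "p ^ s dvd p ^ r" by (simp add: le_imp_power_dvd)
    then show ?thesis using r s by (metis dvd_trans gcd_dvd1)
  qed
qed

lemma gcd_6:
  fixes n :: nat
  shows "gcd n 6 = (if 2 dvd n then if 3 dvd n then 6 else 2 else if 3 dvd n then 3 else 1)"
proof -
  define r where "r = n mod 6"
  then have "r \<in> {0, 1, 2, 3, 4, 5}"
    using mod_less_divisor[of 6 n] by (auto simp del: mod_less_divisor)
  moreover have "gcd n 6 = gcd 6 r"
    unfolding r_def by (simp flip: gcd_red_nat add: gcd.commute)
  moreover have "2 dvd n \<longleftrightarrow> 2 dvd r" "3 dvd n \<longleftrightarrow> 3 dvd r"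
    unfolding r_def by (simp_all add: dvd_mod_iff)
  ultimately show ?thesis by (auto simp: gcd_non_0_nat)
qed

lemma pow_sym_group: "c [^]\<^bsub>sym_group n\<^esub> (k :: nat) = c ^^ k"
  by (induction k) (simp_all add: sym_group_one sym_group_mult funpow_Suc_right del: funpow.simps(2))

lemma finite_sym_group: "finite (carrier (sym_group n))"
  by (simp add: sym_group_def finite_permutations)

text \<open>Natural exponents suffice because in a finite group the inverse is itself a positive
  power.\<close>

lemma generate_sym_group:
  assumes "c permutes {1..n}"
  shows "b \<in> generate (sym_group n) {c} \<longleftrightarrow> (\<exists>k. b = c ^^ k)"
proof -
  interpret group "sym_group n" by (rule sym_group_is_group)
  show ?thesis
    using assms generate_pow_on_finite_carrier[OF finite_sym_group, of c]
    by (auto simp: sym_group_carrier pow_sym_group)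
qed

lemma arc_sym_group:
  "(a, b) \<in> parcs (difference_graph (sym_group n)) \<longleftrightarrow>
    (\<exists>c i j. c permutes {1..n} \<and> a = c ^^ i \<and> b = c ^^ j) \<and>
    (\<nexists>k. a = b ^^ k) \<and> (\<nexists>k. b = a ^^ k)" (is "?L \<longleftrightarrow> ?R")
proof
  assume ?L
  then show ?R
    unfolding parcs_difference_graph Bex_def sym_group_carrier
    using generate_sym_group by metis
next
  assume R: ?R
  then have "a permutes {1..n}" "b permutes {1..n}" by (auto intro: permutes_funpow)
  \<comment> \<open>The exponent 1 turns incomparability into distinctness.\<close>
  moreover have "a = a ^^ 1" by simp
  then have "a \<noteq> b" using R by metis
  ultimately show ?L
    unfolding parcs_difference_graph Bex_def sym_group_carrier
    using R generate_sym_group by metis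
qed

lemma arc_sym_group_sym:
  "(a, b) \<in> parcs (difference_graph (sym_group n)) \<Longrightarrow>
    (b, a) \<in> parcs (difference_graph (sym_group n))"
  unfolding arc_sym_group by blast

section \<open>Five letters\<close>

text \<open>\<open>least_power c x\<close> is the length of the cycle of \<open>c\<close> through
  \<open>x\<close>, and two points of one cycle have the same support as a set.\<close>

lemma least_power_same_orbit:
  assumes "permutation c" "y \<in> set (support c x)"
  shows "least_power c y = least_power c x"
proof -
  have "set (support c y) \<inter> set (support c x) \<noteq> {}"
    using assms disjoint_support' by metis
  then have "set (support c y) = set (support c x)"
    using disjointD[OF disjoint_support[OF assms(1)]] by blast
  then show ?thesis
    using distinct_card[OF cycle_of_permutation[OF assms(1), of x]]
      distinct_card[OF cycle_of_permutation[OF assms(1), of y]] by simp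
qed

text \<open>Cycles of different lengths are disjoint, so their lengths add up to at most 5. Beside a
  3-cycle, a length not dividing 3 can only be 2, and then the two cycles fill \<open>S\<close>. A
  5-cycle fills \<open>S\<close> alone. Without lengths 3 and 5, all lengths divide 4.\<close>

lemma permutes_5_cases:
  assumes c: "c permutes S" and S: "card S = 5"
  obtains (prime_power) p k where "prime p" "c ^^ (p ^ k) = id"
  | (type_3_2) x y where "x \<in> S" "y \<in> S" "least_power c x = 3" "least_power c y = 2"
      "S = set (support c x) \<union> set (support c y)"
proof -
  have fin: "finite S" using S by (metis card.infinite zero_neq_numeral)
  have perm: "permutation c" using c fin permutation_permutes by blast
  let ?O = "\<lambda>x. set (support c x)"
  let ?l = "least_power c"
  have cO: "card (?O x) = ?l x" for x
    using distinct_card[OF cycle_of_permutation[OF perm, of x]] by simp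
  have OS: "?O x \<subseteq> S" if "x \<in> S" for x
    using that permutes_in_image[OF permutes_funpow[OF c]] by auto
  have pos: "?l x > 0" for x by (rule least_power_of_permutation[OF perm])
  have disj: "?O y \<inter> ?O x = {}" if "?l y \<noteq> ?l x" for x y
    using that least_power_same_orbit[OF perm] disjoint_support'[OF perm] by metis
  have sum: "?l x + ?l y \<le> 5" if "x \<in> S" "y \<in> S" "?l y \<noteq> ?l x" for x y
  proof -
    have "?l x + ?l y = card (?O x \<union> ?O y)"
      using disj[of y x] that cO by (subst card_Un_disjoint) auto
    also have "\<dots> \<le> 5" using OS that S fin by (metis Un_least card_mono)
    finally show ?thesis .
  qed
  have le5: "?l x \<le> 5" if "x \<in> S" for x
    using OS[OF that] cO S fin by (metis card_mono)
  have pp: thesis if "prime p" "\<And>x. x \<in> S \<Longrightarrow> ?l x dvd p ^ k" for p k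
  proof (rule prime_power)
    show "prime p" by fact
    show "c ^^ (p ^ k) = id"
    proof
      fix x
      show "(c ^^ (p ^ k)) x = id x"
      proof (cases "x \<in> S")
        case True
        then show ?thesis using that least_power_dvd[OF perm] by simp
      next
        case False
        then show ?thesis using permutes_not_in[OF permutes_funpow[OF c]] by simp
      qed
    qed
  qed
  show thesis
  proof (cases "\<exists>x\<in>S. ?l x = 3")
    case True
    then obtain x where x: "x \<in> S" "?l x = 3" by blast
    show thesis
    proof (cases "\<forall>y\<in>S. ?l y dvd 3")
      case True
      then show thesis using pp[of 3 1] by simp
    next
      case False
      then obtain y where y: "y \<in> S" "\<not> ?l y dvd 3" by blast
      then have "?l y \<noteq> 3" "?l y \<noteq> 1" by auto
      then have "?l y + 3 \<le> 5" "?l y \<noteq> 1" using sum[of x y] x y by auto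
      then have y2: "?l y = 2" using pos[of y] by linarith
      have "card (?O x \<union> ?O y) = card (?O x) + card (?O y)"
        using disj[of y x] x y2 by (intro card_Un_disjoint) auto
      then have "card (?O x \<union> ?O y) = 5"
        unfolding cO using x y2 by simp
      then have "S = ?O x \<union> ?O y"
        using OS x y S fin by (metis Un_least card_subset_eq)
      then show thesis using type_3_2[OF x(1) y(1) x(2) y2] by simp
    qed
  next
    case no3: False
    show thesis
    proof (cases "\<exists>x\<in>S. ?l x = 5")
      case True
      then obtain x where x: "x \<in> S" "?l x = 5" by blast
      have "?l y = 5" if "y \<in> S" for y
        using sum[OF x(1) that] x pos[of y] by (cases "?l y = 5") auto
      then show thesis using pp[of 5 1] by simp
    next
      case False
      have "?l y dvd 2 ^ 2" if "y \<in> S" for y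
      proof -
        have "?l y \<noteq> 3" "?l y \<noteq> 5" "?l y \<le> 5" "?l y > 0"
          using no3 False that le5 pos by auto
        then have "?l y = 1 \<or> ?l y = 2 \<or> ?l y = 4" by linarith
        then show ?thesis by auto
      qed
      then show thesis using pp[of 2 2] by simp
    qed
  qed
qed

text \<open>The common root \<open>c\<close> must have cycle type (3,2), since prime power order
  makes its powers comparable. The transposition is described through the fixed letters of the other
  endpoint, so that this endpoint determines it.\<close>

lemma arc_sym_group_5:
  assumes ab: "(a, b) \<in> parcs (difference_graph (sym_group 5))"
  obtains y z where "y \<noteq> z" "a = transpose y z" "{w \<in> {1..5}. b w = w} = {y, z}"
  | y z where "y \<noteq> z" "b = transpose y z" "{w \<in> {1..5}. a w = w} = {y, z}"
proof -
  from ab obtain c i j where c: "c permutes {1..5}" and a: "a = c ^^ i" and b: "b = c ^^ j"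
    and nab: "\<nexists>k. a = b ^^ k" and nba: "\<nexists>k. b = a ^^ k"
    unfolding arc_sym_group by blast
  \<comment> \<open>For any exponent \<open>m\<close> of \<open>c\<close>, either divisibility would
    make one endpoint a power of the other.\<close>
  have no: "\<not> gcd i m dvd j" "\<not> gcd j m dvd i" if "c ^^ m = id" for m
    using nab nba funpow_power_of_power[OF that] a b by blast+
  have perm: "permutation c" using c permutation_permutes by blast
  have card: "card {1..5::nat} = 5" by simp
  from c card show thesis
  proof (cases rule: permutes_5_cases[where c = c and S = "{1..5}"])
    case (prime_power p k)
    then show thesis
      using no[of "p ^ k"] prime_power_gcd_dvd[of p i k j] by blast
  next
    case (type_3_2 x y)
    let ?O = "\<lambda>x. set (support c x)"
    have Oy: "?O y = {y, c y}"
      by (auto simp: type_3_2(3,4) upt_rec)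
    have l: "least_power c w = 3" if "w \<in> ?O x" for w
      using least_power_same_orbit[OF perm that] type_3_2(3,4) by simp
    have l': "least_power c w = 2" if "w \<in> ?O y" for w
      using least_power_same_orbit[OF perm that] type_3_2(3,4) by simp
    have fix_iff: "(c ^^ k) w = w \<longleftrightarrow> least_power c w dvd k" for k w
      using least_power_dvd[OF perm] by simp
    have neq: "y \<noteq> c y" using fix_iff[of 1 y] type_3_2(3,4) by auto
    have c6: "c ^^ 6 = id"
    proof
      fix w
      consider "w \<notin> {1..5}" | "w \<in> ?O x" | "w \<in> ?O y" using type_3_2(5) by blast
      then have "(c ^^ 6) w = w"
      proof cases
        case 1
        then show ?thesis by (rule permutes_not_in[OF permutes_funpow[OF c]])
      next
        case 2
        then show ?thesis unfolding fix_iff l[OF 2] by simp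
      next
        case 3
        then show ?thesis unfolding fix_iff l'[OF 3] by simp
      qed
      then show "(c ^^ 6) w = id w" by simp
    qed
    \<comment> \<open>Among the divisors 1, 2, 3, 6 of 6, only 2 and 3 are incomparable, so these
      are the gcds of \<open>i\<close> and \<open>j\<close> with 6.\<close>
    have cases: "(2 dvd i \<and> \<not> 3 dvd i \<and> 3 dvd j \<and> \<not> 2 dvd j) \<or>
      (2 dvd j \<and> \<not> 3 dvd j \<and> 3 dvd i \<and> \<not> 2 dvd i)"
      using no[OF c6] unfolding gcd_6 by (simp split: if_splits; presburger)
    \<comment> \<open>Such a power is trivial on the 2-cycle and moves every letter of the
      3-cycle.\<close>
    have fixed: "{w \<in> {1..5}. (c ^^ k) w = w} = {y, c y}" if "2 dvd k" "\<not> 3 dvd k" for k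
    proof -
      have "w \<in> ?O y \<longleftrightarrow> w \<in> {1..5} \<and> least_power c w dvd k" for w
        using l[of w] l'[of w] that unfolding type_3_2(5) by (metis Un_iff)
      then show ?thesis unfolding fix_iff Oy[symmetric] by blast
    qed
    \<comment> \<open>Here the roles are reversed: the power is trivial on the 3-cycle and, its
      exponent being odd, agrees with \<open>c\<close> on the 2-cycle.\<close>
    have swap: "c ^^ k = transpose y (c y)" if "3 dvd k" "\<not> 2 dvd k" for k
    proof
      fix w
      obtain q where q: "k = Suc (2 * q)" using \<open>\<not> 2 dvd k\<close> by (auto elim: oddE)
      have cy: "c (c y) = y" using fix_iff[of 2 y] type_3_2(3,4) by (simp add: numeral_2_eq_2)
      consider "w \<notin> {1..5}" | "w \<in> ?O x" | "w \<in> ?O y" using type_3_2(5) by blast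
      then show "(c ^^ k) w = transpose y (c y) w"
      proof cases
        case 1
        then have "w \<noteq> y" "w \<noteq> c y" using type_3_2(2) permutes_in_image[OF c] by auto
        then show ?thesis
          using permutes_not_in[OF permutes_funpow[OF c] 1] by simp
      next
        case 2
        then have "w \<noteq> y" "w \<noteq> c y" using l[OF 2] l'[of w] unfolding Oy by auto
        then show ?thesis using l[OF 2] fix_iff that by simp
      next
        case 3
        have "(c ^^ k) w = c ((c ^^ (2 * q)) w)" by (simp add: q)
        also have "(c ^^ (2 * q)) w = w" using l'[OF 3] fix_iff by simp
        finally show ?thesis using 3 Oy cy by auto
      qed
    qed
    show thesis
      using cases
    proof (elim disjE conjE)
      assume "2 dvd i" "\<not> 3 dvd i" "3 dvd j" "\<not> 2 dvd j"
      then show thesis using that(2)[OF neq] fixed swap a b by simp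
    next
      assume "2 dvd j" "\<not> 3 dvd j" "3 dvd i" "\<not> 2 dvd i"
      then show thesis using that(1)[OF neq] fixed swap a b by simp
    qed
  qed
qed

text \<open>Each inner vertex of an induced path has two distinct neighbours, but one end of the
  middle edge is a leaf.\<close>

lemma cograph_difference_graph_sym_group_5:
  "cograph (with_proj (difference_graph (sym_group 5)))"
proof -
  let ?E = "parcs (difference_graph (sym_group 5))"
  \<comment> \<open>A vertex \<open>x\<close> with exactly two fixed letters has the transposition
    of these letters as its only neighbour.\<close>
  have leaf: "w = y" if wx: "(w, x) \<in> ?E" and xy: "(x, y) \<in> ?E"
    and p: "p \<noteq> q" "{v \<in> {1..5}. x v = v} = {p, q}" for w x y p q
  proof -
    have "u = transpose p q" if "(u, x) \<in> ?E" for u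
      using that
    proof (cases rule: arc_sym_group_5)
      case (1 p' q')
      then have "{p, q} = {p', q'}" using p(2) by metis
      then show ?thesis using 1(2) by (auto simp: doubleton_eq_iff transpose_commute)
    next
      \<comment> \<open>Here \<open>x\<close> would itself be a transposition and fix at least three
        of the five letters.\<close>
      case (2 p' q')
      have "{v \<in> {1..5}. x v = v} = {1..5} - {p', q'}"
        using 2(1,2) by (auto simp: transpose_def)
      then have "card {p, q} \<ge> card {1..5::nat} - card {p', q'}"
        unfolding p(2) using diff_card_le_card_Diff[of "{p', q'}" "{1..5}"] by simp
      then show ?thesis using p(1) 2(1) by simp
    qed
    then show ?thesis using wx arc_sym_group_sym[OF xy] by metis
  qed
  have False if inj: "inj_on f {..<4}"
    and path: "\<forall>i<4. \<forall>j<4. (f i, f j) \<in> ?E \<longleftrightarrow> (i, j) \<in> parcs (path_graph 4)"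
    for f :: "nat \<Rightarrow> nat \<Rightarrow> nat"
  proof -
    have e: "(f 0, f 1) \<in> ?E" "(f 1, f 2) \<in> ?E" "(f 2, f 3) \<in> ?E"
      using path[rule_format, of 0 1] path[rule_format, of 1 2] path[rule_format, of 2 3]
      by (simp_all add: path_graph_def)
    have n: "f 0 \<noteq> f 2" "f 1 \<noteq> f 3"
      using inj_onD[OF inj, of 0 2] inj_onD[OF inj, of 1 3] by auto
    \<comment> \<open>The 3-cycle on the middle edge is \<open>f 2\<close> in the first case and
      \<open>f 1\<close> in the second; being a leaf, it identifies \<open>f 1\<close> with
      \<open>f 3\<close> or \<open>f 0\<close> with \<open>f 2\<close>.\<close>
    from e(2) show False
    proof (cases rule: arc_sym_group_5)
      case (1 y z)
      then show False
        using leaf[OF e(2,3)] n by blast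
    next
      case (2 y z)
      then show False
        using leaf[OF e(1,2)] n by blast
    qed
  qed
  then show ?thesis
    unfolding cograph_iff[OF pair_graph_difference_graph[OF finite_sym_group]] by blast
qed

section \<open>At least six letters\<close>

text \<open>Both endpoints are powers of one element. In the contrapositive this supplies the
  non-edges of the path.\<close>

lemma arc_sym_group_commute:
  assumes "(a, b) \<in> parcs (difference_graph (sym_group n))"
  shows "a (b x) = b (a x)"
proof -
  obtain c i j where "a = c ^^ i" "b = c ^^ j"
    using assms unfolding arc_sym_group by blast
  then show ?thesis by (metis add.commute comp_apply funpow_add)
qed

text \<open>Commuting elements of coprime orders 2 and 3 are both powers of their product: the third
  power of \<open>p \<circ> q\<close> is \<open>p\<close>, the fourth is \<open>q\<close>.\<close>

lemma arc_sym_group_order_2_3: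
  assumes "p permutes {1..n}" "q permutes {1..n}" and comm: "\<And>x. p (q x) = q (p x)"
    and p: "p ^^ 2 = id" "p \<noteq> id" and q: "q ^^ 3 = id" "q \<noteq> id"
  shows "(p, q) \<in> parcs (difference_graph (sym_group n))"
proof -
  have p2: "p (p x) = x" and q3: "q (q (q x)) = x" for x
    using fun_cong[OF p(1), of x] fun_cong[OF q(1), of x]
    by (simp_all add: numeral_2_eq_2 numeral_3_eq_3)
  have "(p \<circ> q) permutes {1..n}" using assms by (simp add: permutes_compose)
  moreover have "p = (p \<circ> q) ^^ 3" "q = (p \<circ> q) ^^ 4"
    by (auto simp: fun_eq_iff eval_nat_numeral comm p2 q3)
  \<comment> \<open>Cubing kills every power of \<open>q\<close> but leaves the involution
    \<open>p\<close> unchanged. Below, squaring kills the powers of \<open>p\<close>, whereas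
    \<open>q ^^ 2 = id\<close> and \<open>q ^^ 3 = id\<close> would force
    \<open>q = id\<close>.\<close>
  moreover have "p \<noteq> q ^^ k" for k
  proof
    assume pk: "p = q ^^ k"
    have "p ^^ 3 = (q ^^ 3) ^^ k" unfolding pk by (simp add: funpow_mult mult.commute)
    then have "p ^^ 3 = id" using q by simp
    moreover have "p ^^ 3 = p" by (auto simp: fun_eq_iff numeral_3_eq_3 p2)
    ultimately show False using p by simp
  qed
  moreover have "q \<noteq> p ^^ k" for k
  proof
    assume qk: "q = p ^^ k"
    have "q ^^ 2 = (p ^^ 2) ^^ k" unfolding qk by (simp add: funpow_mult mult.commute)
    then have "q ^^ 2 = id" using p by simp
    then have "q (q x) = x" for x by (simp add: numeral_2_eq_2 fun_eq_iff)
    then have "q x = x" for x using q3[of x] by metis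
    then show False using q by auto
  qed
  ultimately show ?thesis unfolding arc_sym_group by blast
qed

text \<open>In the order \<open>a\<close>, \<open>b\<close>, \<open>c\<close>, \<open>d\<close>,
  neighbours on the path have disjoint supports and coprime orders; the other pairs overlap and do
  not commute.\<close>

lemma not_cograph_difference_graph_sym_group:
  assumes "n \<ge> 6"
  shows "\<not> cograph (with_proj (difference_graph (sym_group n)))"
proof -
  let ?E = "parcs (difference_graph (sym_group n))"
  define a b c d :: "nat \<Rightarrow> nat" where
    "a = transpose 5 6" and "b = cycle_of_list [1, 2, 3]" and
    "c = transpose 4 5" and "d = cycle_of_list [1, 2, 6]"
  note defs = a_def b_def c_def d_def
  have perm: "a permutes {1..n}" "b permutes {1..n}" "c permutes {1..n}" "d permutes {1..n}"
    unfolding defs using assms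
    by (intro permutes_swap_id permutes_subset[OF cycle_permutes]; simp)+
  have order: "a ^^ 2 = id" "b ^^ 3 = id" "c ^^ 2 = id" "d ^^ 3 = id"
    by (auto simp: defs fun_eq_iff numeral_2_eq_2 numeral_3_eq_3 transpose_def)
  have neq: "a 5 \<noteq> 5" "b 1 \<noteq> 1" "c 5 \<noteq> 5" "d 1 \<noteq> 1"
    by (auto simp: defs transpose_def)
  then have neq_id: "a \<noteq> id" "b \<noteq> id" "c \<noteq> id" "d \<noteq> id" by auto
  have E: "(a, b) \<in> ?E" "(c, b) \<in> ?E" "(c, d) \<in> ?E"
    by (rule arc_sym_group_order_2_3; (intro perm order neq_id)?; simp add: defs transpose_def)+
  \<comment> \<open>One letter per pair suffices to witness that it does not commute.\<close>
  have "a (c 4) \<noteq> c (a 4)" "a (d 5) \<noteq> d (a 5)" "b (d 1) \<noteq> d (b 1)"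
    by (auto simp: defs transpose_def)
  then have not_E: "(a, c) \<notin> ?E" "(a, d) \<notin> ?E" "(b, d) \<notin> ?E"
    using arc_sym_group_commute by blast+
  have irrefl: "(x, x) \<notin> ?E" for x
    unfolding parcs_difference_graph by simp
  let ?f = "(!) [a, b, c, d]"
  have four: "i < 4 \<longleftrightarrow> i = 0 \<or> i = 1 \<or> i = 2 \<or> i = 3" for i :: nat by auto
  have "distinct [a, b, c, d]"
  proof -
    \<comment> \<open>Any two of the four permutations are told apart by a letter that one fixes and
      the other moves.\<close>
    have "a 1 = 1" "a 4 = 4" "b 5 = 5" "b 3 \<noteq> 3" "c 1 = 1" "c 4 \<noteq> 4" "d 5 = 5" "d 3 = 3"
      by (auto simp: defs transpose_def)
    then show ?thesis using neq by auto
  qed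
  then have "inj_on ?f {..<4}"
    by (intro inj_on_nth) auto
  moreover have "\<forall>i<4. \<forall>j<4. (?f i, ?f j) \<in> ?E \<longleftrightarrow> (i, j) \<in> parcs (path_graph 4)"
    using E not_E E[THEN arc_sym_group_sym] not_E[THEN contrapos_nn, OF arc_sym_group_sym] irrefl
    by (auto simp: four path_graph_def)
  ultimately show ?thesis
    unfolding cograph_iff[OF pair_graph_difference_graph[OF finite_sym_group]] by blast
qed

theorem theorem5p2:
  fixes n :: nat
  assumes "n \<ge> 5"
  shows "cograph (with_proj (difference_graph (sym_group n))) \<longleftrightarrow> n = 5"
proof
  assume "cograph (with_proj (difference_graph (sym_group n)))"
  then show "n = 5"
    using not_cograph_difference_graph_sym_group[of n] assms by linarith
next
  assume "n = 5"
  then show "cograph (with_proj (difference_graph (sym_group n)))"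
    using cograph_difference_graph_sym_group_5 by simp
qed

end
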